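(* Suppose $q\in(1,2]$ and for some constants $a,b\in(0,\infty)$ we have $$|\nabla U|^q\le aU+b ,$$ and assume that the probability measure $d\mu\equiv e^{-U}d\lambda/Z$ satisfies $\mathbf{LS}_q$, i.e. there is a constant $c\in(0,\infty)$ independent of $f$ such that $$\mu\Big(|f|^q\log\frac{|f|^q}{\mu|f|^q}\Big)\le c\,\mu|\nabla f|^q .$$ Then the following U-bound is true: $$\int|f|^q\,U\,d\mu\le C\int|\nabla f|^q\,d\mu+D\int|f|^q\,d\mu$$ with some constants $C,D\in(0,\infty)$ independent of $f$.
   Context: $\lambda$ is Lebesgue measure on $\mathbb{R}^N$, $U$ is a function on $\mathbb{R}^N$ and $Z$ is the normalisation constant. $\nabla=(X_1,\dots,X_k)$ is a subgradient in $\mathbb{R}^N$, i.e. a finite collection of possibly noncommuting vector fields, each with zero divergence with respect to $\lambda$; $\nabla f=(X_1f,\dots,X_kf)$ and $|\nabla f|=(\sum_i (X_if)^2)^{1/2}$. Notation: $\mu g=\int g\,d\mu$. $f$ ranges over functions for which $|\nabla f|$ is well defined. *)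

theory Defs
  imports "HOL-Analysis.Analysis" "HOL-Probability.Probability_Measure"
begin

text \<open>The fields are C1 on the whole space, the regularity needed for a pointwise divergence and
  for unique local integral curves.\<close>

definition C1_vector_field :: "(real ^ 'n \<Rightarrow> real ^ 'n) \<Rightarrow> bool" where
  "C1_vector_field X \<longleftrightarrow>
     (\<exists>X' :: real ^ 'n \<Rightarrow> (real ^ 'n) \<Rightarrow>\<^sub>L (real ^ 'n).
        (\<forall>x. (X has_derivative blinfun_apply (X' x)) (at x)) \<and> continuous_on UNIV X')"

definition divergence :: "(real ^ 'n \<Rightarrow> real ^ 'n) \<Rightarrow> real ^ 'n \<Rightarrow> real" where
  "divergence X x = (\<Sum>j\<in>UNIV. frechet_derivative X (at x) (axis j 1) $ j)"

definition subgradient_fields :: "('k::finite \<Rightarrow> real ^ 'n \<Rightarrow> real ^ 'n) \<Rightarrow> bool" where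
  "subgradient_fields X \<longleftrightarrow> (\<forall>i. C1_vector_field (X i) \<and> (\<forall>x. divergence (X i) x = 0))"

definition integral_curve_on ::
    "(real ^ 'n \<Rightarrow> real ^ 'n) \<Rightarrow> (real \<Rightarrow> real ^ 'n) \<Rightarrow> real \<Rightarrow> real \<Rightarrow> bool" where
  "integral_curve_on X \<gamma> s t \<longleftrightarrow>
     (\<forall>r\<in>{s..t}. (\<gamma> has_vector_derivative X (\<gamma> r)) (at r within {s..t}))"

text \<open>The pairs in \<open>P\<close> are the end points of finitely many non-overlapping subintervals.\<close>

definition abs_continuous_on_interval :: "(real \<Rightarrow> real) \<Rightarrow> real \<Rightarrow> real \<Rightarrow> bool" where
  "abs_continuous_on_interval h s t \<longleftrightarrow>
     (\<forall>\<epsilon>>0. \<exists>\<delta>>0. \<forall>P :: (real \<times> real) set.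
        finite P \<and> (\<forall>(u, v)\<in>P. s \<le> u \<and> u \<le> v \<and> v \<le> t) \<and>
        pairwise (\<lambda>(u, v) (u', v'). {u<..<v} \<inter> {u'<..<v'} = {}) P \<and>
        (\<Sum>(u, v)\<in>P. v - u) < \<delta> \<longrightarrow>
        (\<Sum>(u, v)\<in>P. \<bar>h v - h u\<bar>) < \<epsilon>)"

text \<open>\<open>has_subgradient X f G\<close>: \<open>f\<close> is a function whose subgradient \<open>(X\<^sub>1 f, \<dots>, X\<^sub>k f)\<close> is well
  defined, and it is \<open>G\<close>. Here \<open>X\<^sub>i f\<close> is the derivative of \<open>f\<close> along the integral curves of \<open>X\<^sub>i\<close>.
  Kinks are admitted (a Lipschitz function such as a distance, say): the derivative is taken at almost
  every time and \<open>f\<close> is absolutely continuous along the curves. For C1 functions \<open>f\<close> this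
  is the usual \<open>X\<^sub>i f x = Df(x) (X\<^sub>i x)\<close>. The field \<open>G\<close> is determined up to Lebesgue null sets, hence
  the relational form. Its Euclidean norm is the length of the subgradient.\<close>

definition has_subgradient ::
    "('k::finite \<Rightarrow> real ^ 'n \<Rightarrow> real ^ 'n) \<Rightarrow> (real ^ 'n \<Rightarrow> real) \<Rightarrow> (real ^ 'n \<Rightarrow> real ^ 'k) \<Rightarrow> bool"
  where
  "has_subgradient X f G \<longleftrightarrow>
     f \<in> borel_measurable borel \<and> G \<in> borel_measurable borel \<and>
     (\<forall>i \<gamma> s t. s < t \<and> integral_curve_on (X i) \<gamma> s t \<longrightarrow>
        abs_continuous_on_interval (f \<circ> \<gamma>) s t \<and>
        (AE r in lborel. r \<in> {s<..<t} \<longrightarrow>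
           ((f \<circ> \<gamma>) has_real_derivative G (\<gamma> r) $ i) (at r)))"

definition gibbs_measure :: "(real ^ 'n \<Rightarrow> real) \<Rightarrow> (real ^ 'n) measure" where
  "gibbs_measure U =
     density lborel (\<lambda>x. ennreal (exp (- U x) / (LINT y|lborel. exp (- U y))))"

text \<open>The inequality is required whenever \<open>\<bar>f\<bar>\<^sup>q\<close> and the q-th power of the length of the subgradient
  are integrable. In this case the negative part of the entropy integrand is
  integrable, and the clause on integrability says that its (possibly infinite) integral is finite,
  as the inequality demands. The convention \<open>0 log 0 = 0\<close> is built in.\<close>

definition LS ::
    "real \<Rightarrow> ('k::finite \<Rightarrow> real ^ 'n \<Rightarrow> real ^ 'n) \<Rightarrow> (real ^ 'n) measure \<Rightarrow> bool" where
  "LS q X \<mu> \<longleftrightarrow>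
     (\<exists>c>0. \<forall>f G. has_subgradient X f G \<longrightarrow>
        integrable \<mu> (\<lambda>x. \<bar>f x\<bar> powr q) \<longrightarrow> integrable \<mu> (\<lambda>x. norm (G x) powr q) \<longrightarrow>
        integrable \<mu> (\<lambda>x. \<bar>f x\<bar> powr q * ln (\<bar>f x\<bar> powr q / (LINT y|\<mu>. \<bar>f y\<bar> powr q))) \<and>
        (LINT x|\<mu>. \<bar>f x\<bar> powr q * ln (\<bar>f x\<bar> powr q / (LINT y|\<mu>. \<bar>f y\<bar> powr q)))
          \<le> c * (LINT x|\<mu>. norm (G x) powr q))"

end

theory Submission
  imports Defs
begin

text \<open>By the entropy (Young) inequality the U-bound follows from \<open>LS\<close> once some exponential moment
  of \<open>U\<close> is finite. Put \<open>W = U + b/a\<close>, so that \<open>W \<ge> 0\<close> and \<open>\<bar>\<nabla>W\<bar>\<^sup>q \<le> a W\<close> almost everywhere;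
  the bounded truncations \<open>V = arctan (s W) / s\<close> satisfy the same two inequalities. Testing \<open>LS\<close> with
  \<open>exp (\<epsilon> V / q)\<close> gives, for small \<open>\<epsilon>\<close> (here \<open>q > 1\<close> enters), \<open>\<mu> (\<epsilon> V e\<^sup>\<epsilon>\<^sup>V) \<le> 2 M ln M\<close> with
  \<open>M = \<mu> e\<^sup>\<epsilon>\<^sup>V\<close>. Whenever \<open>M = 4\<close>, this makes \<open>e\<^sup>\<epsilon>\<^sup>V\<close> uniformly integrable, and the small mass
  of the tail \<open>{W > r}\<close> then forces \<open>M < 4\<close>. Since \<open>M\<close> is continuous in \<open>\<epsilon>\<close> and equals 1 at 0, it
  never reaches 4, uniformly in the truncation.\<close>

section \<open>Chain rule for the subgradient\<close>

lemma abs_continuous_on_interval_lipschitz_comp: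
  assumes h: "abs_continuous_on_interval h s t"
    and L: "\<And>x y. \<bar>\<psi> x - \<psi> y\<bar> \<le> L * \<bar>x - y\<bar>"
  shows "abs_continuous_on_interval (\<psi> \<circ> h) s t"
  unfolding abs_continuous_on_interval_def
proof (intro allI impI)
  fix e :: real assume e: "0 < e"
  \<comment> \<open>The maximum with 1 keeps the divisor in \<open>e / K\<close> positive when
    \<open>L\<close> is 0.\<close>
  define K where "K = max L 1"
  have K: "K > 0" "L \<le> K" by (auto simp: K_def)
  obtain d where d: "d > 0" and *: "\<And>P :: (real \<times> real) set.
        finite P \<and> (\<forall>(u, v)\<in>P. s \<le> u \<and> u \<le> v \<and> v \<le> t) \<and>
        pairwise (\<lambda>(u, v) (u', v'). {u<..<v} \<inter> {u'<..<v'} = {}) P \<and>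
        (\<Sum>(u, v)\<in>P. v - u) < d \<Longrightarrow> (\<Sum>(u, v)\<in>P. \<bar>h v - h u\<bar>) < e / K"
    using h[unfolded abs_continuous_on_interval_def, rule_format, OF divide_pos_pos[OF e K(1)]]
    by blast
  show "\<exists>d>0. \<forall>P :: (real \<times> real) set.
        finite P \<and> (\<forall>(u, v)\<in>P. s \<le> u \<and> u \<le> v \<and> v \<le> t) \<and>
        pairwise (\<lambda>(u, v) (u', v'). {u<..<v} \<inter> {u'<..<v'} = {}) P \<and>
        (\<Sum>(u, v)\<in>P. v - u) < d \<longrightarrow> (\<Sum>(u, v)\<in>P. \<bar>(\<psi> \<circ> h) v - (\<psi> \<circ> h) u\<bar>) < e"
  proof (intro exI[of _ d] conjI d allI impI)
    fix P :: "(real \<times> real) set"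
    assume P: "finite P \<and> (\<forall>(u, v)\<in>P. s \<le> u \<and> u \<le> v \<and> v \<le> t) \<and>
        pairwise (\<lambda>(u, v) (u', v'). {u<..<v} \<inter> {u'<..<v'} = {}) P \<and>
        (\<Sum>(u, v)\<in>P. v - u) < d"
    have "(\<Sum>(u, v)\<in>P. \<bar>(\<psi> \<circ> h) v - (\<psi> \<circ> h) u\<bar>) \<le> (\<Sum>(u, v)\<in>P. K * \<bar>h v - h u\<bar>)"
      by (rule sum_mono) (auto intro!: order_trans[OF L] mult_right_mono K)
    also have "\<dots> = K * (\<Sum>(u, v)\<in>P. \<bar>h v - h u\<bar>)"
      by (simp add: sum_distrib_left case_prod_unfold)
    also have "\<dots> < K * (e / K)"
      using *[OF P] K by (intro mult_strict_left_mono)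
    finally show "(\<Sum>(u, v)\<in>P. \<bar>(\<psi> \<circ> h) v - (\<psi> \<circ> h) u\<bar>) < e"
      using K by simp
  qed
qed

text \<open>The bound on \<open>\<psi>'\<close> makes \<open>\<psi>\<close> Lipschitz, which
  preserves absolute continuity along the integral curves. As \<open>\<psi>\<close> is
  differentiable everywhere, the ordinary chain rule applies at each time where
  \<open>f \<circ> \<gamma>\<close> has its derivative, so the exceptional null set of times does
  not grow.\<close>

lemma has_subgradient_comp:
  fixes X :: "'k::finite \<Rightarrow> real ^ 'n \<Rightarrow> real ^ 'n"
  assumes f: "has_subgradient X f G"
    and D: "\<And>x. (\<psi> has_real_derivative \<psi>' x) (at x)"
    and B: "\<And>x. \<bar>\<psi>' x\<bar> \<le> L"
    and M: "\<psi>' \<in> borel_measurable borel"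
  shows "has_subgradient X (\<lambda>x. \<psi> (f x)) (\<lambda>x. \<psi>' (f x) *\<^sub>R G x)"
proof -
  have [measurable]: "f \<in> borel_measurable borel" "G \<in> borel_measurable borel"
    using f by (auto simp: has_subgradient_def)
  note [measurable] = M
  have "continuous_on UNIV \<psi>"
    by (intro continuous_at_imp_continuous_on ballI DERIV_isCont[OF D])
  then have [measurable]: "\<psi> \<in> borel_measurable borel"
    by (rule borel_measurable_continuous_onI)
  have L: "\<bar>\<psi> x - \<psi> y\<bar> \<le> L * \<bar>x - y\<bar>" for x y
    using field_differentiable_bound[of UNIV \<psi> \<psi>' L x y, OF convex_UNIV] D B
    unfolding real_norm_def by blast
  have "abs_continuous_on_interval ((\<lambda>x. \<psi> (f x)) \<circ> \<gamma>) s t \<and>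
        (AE r in lborel. r \<in> {s<..<t} \<longrightarrow>
           (((\<lambda>x. \<psi> (f x)) \<circ> \<gamma>) has_real_derivative (\<psi>' (f (\<gamma> r)) *\<^sub>R G (\<gamma> r)) $ i) (at r))"
    if "s < t" "integral_curve_on (X i) \<gamma> s t" for i \<gamma> s t
  proof
    have ac: "abs_continuous_on_interval (f \<circ> \<gamma>) s t"
      and ae: "AE r in lborel. r \<in> {s<..<t} \<longrightarrow>
           ((f \<circ> \<gamma>) has_real_derivative G (\<gamma> r) $ i) (at r)"
      using f that by (auto simp: has_subgradient_def)
    show "abs_continuous_on_interval ((\<lambda>x. \<psi> (f x)) \<circ> \<gamma>) s t"
      using abs_continuous_on_interval_lipschitz_comp[OF ac L] by (simp add: o_def)
    show "AE r in lborel. r \<in> {s<..<t} \<longrightarrow>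
           (((\<lambda>x. \<psi> (f x)) \<circ> \<gamma>) has_real_derivative (\<psi>' (f (\<gamma> r)) *\<^sub>R G (\<gamma> r)) $ i) (at r)"
      using ae
    proof eventually_elim
      case (elim r)
      then show ?case
        using DERIV_chain[OF D, of "f \<circ> \<gamma>"] by (auto simp: o_def)
    qed
  qed
  then show ?thesis
    unfolding has_subgradient_def by auto
qed

section \<open>Elementary facts on the arctangent and the exponential\<close>

text \<open>The derivative of arctan decreases on the positive half-line, so the mean slope on
  \<open>[0, x]\<close> is at least the slope at \<open>x\<close>. With \<open>x = s * W\<close>
  this bounds \<open>W\<close> times the derivative of the truncation by the truncation
  itself.\<close>

lemma arctan_ge_self_div_one_plus_square:
  fixes x :: real
  assumes "0 \<le> x"
  shows "x / (1 + x\<^sup>2) \<le> arctan x"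
proof (cases "x = 0")
  case False
  with assms have "0 < x" by simp
  from MVT2[OF this, of arctan "\<lambda>x. inverse (1 + x\<^sup>2)"] obtain z
    where z: "0 < z" "z < x" "arctan x = x * inverse (1 + z\<^sup>2)"
    by (auto intro: DERIV_arctan)
  have "inverse (1 + x\<^sup>2) \<le> inverse (1 + z\<^sup>2)"
    using z by (intro le_imp_inverse_le add_left_mono power_mono) (auto intro: add_pos_nonneg)
  then show ?thesis
    using z by (simp add: divide_inverse mult_left_mono)
qed simp

text \<open>The quotient is the difference quotient at 0 of \<open>arctan (s * w)\<close> as a
  function of \<open>s\<close>. The limit removes the truncation.\<close>

lemma tendsto_arctan_div: "((\<lambda>s. arctan (s * w) / s) \<longlongrightarrow> w) (at 0)"
proof -
  have "((\<lambda>s. arctan (s * w)) has_real_derivative w) (at 0)"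
    by (auto intro!: derivative_eq_intros)
  then show ?thesis
    by (simp add: has_field_derivative_iff)
qed

text \<open>Convex duality between \<open>exp\<close> and \<open>x * ln x - x\<close>: it is
  \<open>1 + u \<le> exp u\<close> at \<open>u = y - ln x\<close>, multiplied by
  \<open>x\<close>.\<close>

lemma young_exp:
  fixes x y :: real
  assumes "0 \<le> x"
  shows "x * y \<le> x * ln x - x + exp y"
proof (cases "x = 0")
  case False
  with assms have x: "x > 0" by simp
  have "1 + (y - ln x) \<le> exp (y - ln x)" by (rule exp_ge_add_one_self)
  then have "x * (1 + (y - ln x)) \<le> x * exp (y - ln x)"
    using x by (intro mult_left_mono) auto
  also have "\<dots> = exp y" using x by (simp add: exp_diff)
  finally show ?thesis by (simp add: algebra_simps)
qed simp

section \<open>Exponential moments and entropy on a probability space\<close>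

context prob_space
begin

lemma prob_tail_small:
  fixes W :: "'a \<Rightarrow> real"
  assumes [measurable]: "W \<in> borel_measurable M" and "0 < \<delta>"
  obtains r where "0 < r" "prob {x\<in>space M. W x > r} < \<delta>"
proof -
  have "(\<lambda>n::nat. prob {x\<in>space M. W x > real n}) \<longlonglongrightarrow> prob (\<Inter>n::nat. {x\<in>space M. W x > real n})"
    by (intro finite_Lim_measure_decseq) (auto simp: decseq_def)
  also have "(\<Inter>n::nat. {x\<in>space M. W x > real n}) = {}"
    using reals_Archimedean2 by (auto, meson not_less_iff_gr_or_eq)
  finally have "eventually (\<lambda>n::nat. prob {x\<in>space M. W x > real n} < \<delta>) sequentially"
    using assms(2) by (auto intro: order_tendstoD)
  then obtain N where N: "\<And>n::nat. n \<ge> N \<Longrightarrow> prob {x\<in>space M. W x > real n} < \<delta>"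
    by (auto simp: eventually_sequentially)
  \<comment> \<open>The successor makes the threshold strictly positive even if \<open>N\<close> is
    0.\<close>
  show ?thesis using N[of "Suc N"] by (intro that[of "real (Suc N)"]) auto
qed

text \<open>Let \<open>T = 8 * ln 4\<close>. The integrand is at most 2 where
  \<open>V \<le> r\<close>; it is at most \<open>exp T\<close> on the part of the tail where
  \<open>\<epsilon> * V \<le> T\<close>, and the tail has mass at most \<open>exp (- T) / 2\<close>;
  elsewhere it is at most \<open>\<epsilon> * V * exp (\<epsilon> * V) / T\<close>, whose
  expectation is at most 1. The three contributions add up to at most 7/2.\<close>

lemma exponential_moment_lt_4:
  fixes V :: "'a \<Rightarrow> real"
  assumes [measurable]: "V \<in> borel_measurable M"
    and bd: "AE x in M. 0 \<le> V x \<and> V x \<le> B"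
    and "0 < \<epsilon>" and er: "exp (\<epsilon> * r) \<le> 2"
    and ent: "expectation (\<lambda>x. \<epsilon> * V x * exp (\<epsilon> * V x)) \<le> 8 * ln 4"
    and tail: "prob {x\<in>space M. V x > r} \<le> exp (- 8 * ln 4) / 2"
  shows "expectation (\<lambda>x. exp (\<epsilon> * V x)) < 4"
proof -
  define T :: real where "T = 8 * ln 4"
  have T: "T > 0" by (simp add: T_def)
  have bd': "AE x in M. \<bar>V x\<bar> \<le> B \<and> exp (\<epsilon> * V x) \<le> exp (\<epsilon> * B)"
    using bd by eventually_elim (use \<open>0 < \<epsilon>\<close> in auto)
  have i1: "integrable M (\<lambda>x. exp (\<epsilon> * V x))"
    by (rule integrable_const_bound[of _ "exp (\<epsilon> * B)"]) (use bd' in auto)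
  have i2: "integrable M (\<lambda>x. \<epsilon> * V x * exp (\<epsilon> * V x))"
  proof (rule integrable_const_bound)
    show "AE x in M. norm (\<epsilon> * V x * exp (\<epsilon> * V x)) \<le> \<epsilon> * B * exp (\<epsilon> * B)"
      using bd'
    proof eventually_elim
      case (elim x)
      moreover have "0 \<le> B" using elim by linarith
      ultimately show ?case
        using \<open>0 < \<epsilon>\<close> unfolding real_norm_def abs_mult by (intro mult_mono) auto
    qed
  qed simp
  let ?A = "{x\<in>space M. V x > r}"
  have iA: "integrable M (indicat_real ?A)"
    by (rule integrable_const_bound[of _ 1]) auto
  have "expectation (\<lambda>x. exp (\<epsilon> * V x))
      \<le> expectation (\<lambda>x. 2 + exp T * indicator ?A x + (\<epsilon> * V x * exp (\<epsilon> * V x)) / T)"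
  proof (rule integral_mono_AE)
    show "AE x in M. exp (\<epsilon> * V x)
        \<le> 2 + exp T * indicator ?A x + (\<epsilon> * V x * exp (\<epsilon> * V x)) / T"
      using bd AE_space
    proof eventually_elim
      case (elim x)
      then have nn: "0 \<le> \<epsilon> * V x * exp (\<epsilon> * V x) / T" using T \<open>0 < \<epsilon>\<close> by auto
      consider "V x \<le> r" | "V x > r" "\<epsilon> * V x \<le> T" | "V x > r" "\<epsilon> * V x > T" by linarith
      then show ?case
      proof cases
        case 1
        then have "exp (\<epsilon> * V x) \<le> exp (\<epsilon> * r)" using \<open>0 < \<epsilon>\<close> by simp
        also note er
        finally show ?thesis using nn 1 by simp
      next
        case 2
        then have "exp (\<epsilon> * V x) \<le> exp T" by simp
        with 2 nn elim show ?thesis by (simp del: exp_le_cancel_iff)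
      next
        case 3
        then have "T * exp (\<epsilon> * V x) \<le> \<epsilon> * V x * exp (\<epsilon> * V x)"
          by (intro mult_right_mono) auto
        then have "exp (\<epsilon> * V x) \<le> \<epsilon> * V x * exp (\<epsilon> * V x) / T"
          using T by (simp add: field_simps)
        with 3 elim show ?thesis by (simp add: add_increasing)
      qed
    qed
  qed (intro i1 i2 iA Bochner_Integration.integrable_add integrable_mult_right integrable_divide
      integrable_const)+
  also have "\<dots> = 2 + exp T * prob ?A + expectation (\<lambda>x. \<epsilon> * V x * exp (\<epsilon> * V x)) / T"
    using i2 iA by (simp add: prob_space)
  also have "\<dots> \<le> 2 + exp T * (exp (- T) / 2) + T / T"
    using ent tail T by (intro add_mono mult_left_mono divide_right_mono) (auto simp: T_def)
  also have "\<dots> < 4" using T by (simp add: exp_minus)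
  finally show ?thesis .
qed

lemma continuous_on_exponential_moment:
  fixes V :: "'a \<Rightarrow> real"
  assumes [measurable]: "V \<in> borel_measurable M"
    and bd: "AE x in M. 0 \<le> V x \<and> V x \<le> B"
  shows "continuous_on {0..e} (\<lambda>\<epsilon>. expectation (\<lambda>x. exp (\<epsilon> * V x)))"
  unfolding continuous_on_sequentially comp_def
proof (intro allI ballI impI, elim conjE)
  fix u :: "nat \<Rightarrow> real" and l
  assume l: "l \<in> {0..e}" and u: "\<forall>n. u n \<in> {0..e}" and lim: "u \<longlonglongrightarrow> l"
  show "(\<lambda>n. expectation (\<lambda>x. exp (u n * V x))) \<longlonglongrightarrow> expectation (\<lambda>x. exp (l * V x))"
  proof (rule integral_dominated_convergence[where w = "\<lambda>_. exp (e * B)"])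
    show "AE x in M. (\<lambda>n. exp (u n * V x)) \<longlonglongrightarrow> exp (l * V x)"
      by (intro AE_I2 tendsto_intros lim)
    show "AE x in M. norm (exp (u n * V x)) \<le> exp (e * B)" for n
      using bd by eventually_elim (use u[rule_format, of n] in \<open>auto intro!: mult_mono\<close>)
  qed auto
qed

text \<open>The moment inequality is only needed where the moment equals 4, because the argument is by
  continuity in the exponent.\<close>

lemma exponential_moment_le_4:
  fixes V :: "'a \<Rightarrow> real"
  assumes [measurable]: "V \<in> borel_measurable M"
    and bd: "AE x in M. 0 \<le> V x \<and> V x \<le> B"
    and "0 < e" and "0 \<le> r" and er: "exp (e * r) \<le> 2"
    and ent: "\<And>\<epsilon>. 0 < \<epsilon> \<Longrightarrow> \<epsilon> \<le> e \<Longrightarrow> expectation (\<lambda>x. exp (\<epsilon> * V x)) = 4 \<Longrightarrow>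
       expectation (\<lambda>x. \<epsilon> * V x * exp (\<epsilon> * V x)) \<le> 8 * ln 4"
    and tail: "prob {x\<in>space M. V x > r} \<le> exp (- 8 * ln 4) / 2"
  shows "expectation (\<lambda>x. exp (e * V x)) \<le> 4"
proof (rule ccontr)
  assume "\<not> ?thesis"
  \<comment> \<open>The moment is 1 at exponent 0 and, by the assumption to be refuted, exceeds 4 at
    \<open>e\<close>.\<close>
  then have "\<exists>\<epsilon>\<ge>0. \<epsilon> \<le> e \<and> expectation (\<lambda>x. exp (\<epsilon> * V x)) = 4"
    using assms(3) by (intro IVT' continuous_on_exponential_moment[OF assms(1) bd])
      (auto simp: prob_space)
  then obtain \<epsilon> where e: "0 \<le> \<epsilon>" "\<epsilon> \<le> e" and eq: "expectation (\<lambda>x. exp (\<epsilon> * V x)) = 4"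
    by blast
  have "\<epsilon> \<noteq> 0" using eq by (auto simp: prob_space)
  with e have pos: "0 < \<epsilon>" by simp
  have "exp (\<epsilon> * r) \<le> 2"
    using e \<open>0 \<le> r\<close> by (intro order_trans[OF _ er]) (simp add: mult_right_mono)
  from exponential_moment_lt_4[OF assms(1) bd pos this ent[OF pos e(2) eq] tail] eq
  show False by simp
qed

lemma entropy_exp:
  fixes V :: "'a \<Rightarrow> real"
  assumes [measurable]: "V \<in> borel_measurable M"
    and i1: "integrable M (\<lambda>x. exp (\<epsilon> * V x))"
    and i2: "integrable M (\<lambda>x. \<epsilon> * V x * exp (\<epsilon> * V x))"
    and m: "m = expectation (\<lambda>x. exp (\<epsilon> * V x))" "0 < m"
  shows "expectation (\<lambda>x. exp (\<epsilon> * V x) * ln (exp (\<epsilon> * V x) / m))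
     = expectation (\<lambda>x. \<epsilon> * V x * exp (\<epsilon> * V x)) - m * ln m"
proof -
  have "expectation (\<lambda>x. exp (\<epsilon> * V x) * ln (exp (\<epsilon> * V x) / m))
     = expectation (\<lambda>x. \<epsilon> * V x * exp (\<epsilon> * V x) - exp (\<epsilon> * V x) * ln m)"
    using m by (intro Bochner_Integration.integral_cong refl) (simp add: ln_div algebra_simps)
  also have "\<dots> = expectation (\<lambda>x. \<epsilon> * V x * exp (\<epsilon> * V x)) - m * ln m"
    using i1 i2 by (simp add: m(1))
  finally show ?thesis .
qed

text \<open>Apply \<open>young_exp\<close> to \<open>g\<close> divided by its mean, multiply by the
  mean and integrate. Nonnegativity of \<open>g * W\<close> turns the pointwise upper bound into
  integrability as well.\<close>

lemma entropy_inequality: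
  fixes g W :: "'a \<Rightarrow> real"
  assumes [measurable]: "g \<in> borel_measurable M" "W \<in> borel_measurable M"
    and g: "AE x in M. 0 \<le> g x" and W: "AE x in M. 0 \<le> W x"
    and ig: "integrable M g"
    and ient: "integrable M (\<lambda>x. g x * ln (g x / expectation g))"
    and iexp: "integrable M (\<lambda>x. exp (W x))"
  shows "integrable M (\<lambda>x. g x * W x)"
    and "expectation (\<lambda>x. g x * W x) \<le> expectation (\<lambda>x. g x * ln (g x / expectation g))
           + expectation g * expectation (\<lambda>x. exp (W x))"
proof -
  let ?m = "expectation g"
  let ?h = "\<lambda>x. g x * ln (g x / ?m) + ?m * exp (W x)"
  have m0: "0 \<le> ?m" using g by (rule integral_nonneg_AE)
  have ih: "integrable M ?h" using ient iexp by auto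
  have le: "AE x in M. 0 \<le> g x * W x \<and> g x * W x \<le> ?h x"
  proof (cases "?m = 0")
    \<comment> \<open>Normalising by the mean is impossible here, but \<open>g\<close> vanishes
      almost everywhere, so both sides are 0.\<close>
    case True
    then have "AE x in M. g x = 0"
      using integral_nonneg_eq_0_iff_AE[OF ig g] by simp
    then show ?thesis by eventually_elim (simp add: True)
  next
    case False
    with m0 have m: "?m > 0" by simp
    show ?thesis using g W
    proof eventually_elim
      case (elim x)
      have "?m * (g x / ?m * W x) \<le> ?m * (g x / ?m * ln (g x / ?m) - g x / ?m + exp (W x))"
        using elim m by (intro mult_left_mono young_exp) auto
      then have "g x * W x \<le> g x * ln (g x / ?m) - g x + ?m * exp (W x)"
        using m by (simp add: algebra_simps)
      with elim show ?case by simp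
    qed
  qed
  show i: "integrable M (\<lambda>x. g x * W x)"
    by (rule Bochner_Integration.integrable_bound[OF ih]) (use le in auto)
  have "expectation (\<lambda>x. g x * W x) \<le> expectation ?h"
    by (rule integral_mono_AE[OF i ih]) (use le in auto)
  also have "\<dots> = expectation (\<lambda>x. g x * ln (g x / ?m)) + ?m * expectation (\<lambda>x. exp (W x))"
    using ient iexp by simp
  finally show "expectation (\<lambda>x. g x * W x) \<le> \<dots>" .
qed

end

section \<open>Exponential integrability from the logarithmic Sobolev inequality\<close>

text \<open>The exponent \<open>e\<close> and the threshold \<open>r\<close> are fixed before the
  truncation parameter \<open>s\<close>, so the moment bound 4 is uniform in \<open>s\<close> and
  survives the limit by Fatou's lemma.\<close>

lemma LS_exponential_integrable:
  fixes X :: "'k::finite \<Rightarrow> real ^ 'n \<Rightarrow> real ^ 'n"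
  assumes W: "has_subgradient X W DW"
    and bd: "AE x in \<mu>. norm (DW x) powr q \<le> a * W x"
    and \<mu>: "prob_space \<mu>" and sets: "sets \<mu> = sets borel"
    and LS: "LS q X \<mu>"
    and q: "1 < q" and a: "0 < a"
  shows "\<exists>e>0. integrable \<mu> (\<lambda>x. exp (e * W x))"
proof -
  interpret prob_space \<mu> by (rule \<mu>)
  have [measurable_cong]: "sets \<mu> = sets borel" by (rule sets)
  have [measurable]: "W \<in> borel_measurable borel" "DW \<in> borel_measurable borel"
    using W by (auto simp: has_subgradient_def)
  have W0: "AE x in \<mu>. 0 \<le> W x"
    using bd
  proof eventually_elim
    case (elim x)
    then have "0 \<le> a * W x" by (rule order_trans[rotated]) simp
    then show ?case using a by (simp add: zero_le_mult_iff)
  qed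
  obtain c where c: "c > 0" and LS: "\<And>f G. has_subgradient X f G \<Longrightarrow>
        integrable \<mu> (\<lambda>x. \<bar>f x\<bar> powr q) \<Longrightarrow> integrable \<mu> (\<lambda>x. norm (G x) powr q) \<Longrightarrow>
        (LINT x|\<mu>. \<bar>f x\<bar> powr q * ln (\<bar>f x\<bar> powr q / (LINT y|\<mu>. \<bar>f y\<bar> powr q)))
          \<le> c * (LINT x|\<mu>. norm (G x) powr q)"
    using LS unfolding LS_def by blast
  obtain r where r: "0 < r" and tail: "prob {x\<in>space \<mu>. W x > r} < exp (- 8 * ln 4) / 2"
    by (rule prob_tail_small[of W "exp (- 8 * ln 4) / 2"]) auto
  \<comment> \<open>The first entry gives \<open>exp (e * r) \<le> 2\<close>; the second gives
    \<open>c * a * \<epsilon> powr (q - 1) \<le> 1 / 2\<close> for all \<open>\<epsilon>\<close> up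
    to \<open>e\<close>, the factor that permits absorption below.\<close>
  define e where "e = min (ln 2 / r) ((1 / (2 * c * a)) powr (1 / (q - 1)))"
  have e: "e > 0" using r c a by (auto simp: e_def)
  have er: "exp (e * r) \<le> 2"
  proof -
    have "e * r \<le> ln 2" using r by (simp add: e_def min_def field_simps)
    then show ?thesis by (metis exp_le_cancel_iff exp_ln zero_less_numeral)
  qed
  have small: "c * a * \<epsilon> powr (q - 1) \<le> 1 / 2" if "0 < \<epsilon>" "\<epsilon> \<le> e" for \<epsilon>
  proof -
    have "\<epsilon> powr (q - 1) \<le> ((1 / (2 * c * a)) powr (1 / (q - 1))) powr (q - 1)"
      using that q by (intro powr_mono2) (auto simp: e_def)
    also have "\<dots> = 1 / (2 * c * a)" using q c a by (simp add: powr_powr)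
    finally show ?thesis using c a by (simp add: field_simps)
  qed
  \<comment> \<open>Unlike a minimum with a constant, this truncation is differentiable everywhere,
    as \<open>has_subgradient_comp\<close> demands. Its boundedness makes every integral below
    finite and its exponential Lipschitz in \<open>W\<close>.\<close>
  define V where "V s x = arctan (s * W x) / s" for s x
  have [measurable]: "V s \<in> borel_measurable borel" for s
    unfolding V_def by measurable
  have moment: "expectation (\<lambda>x. exp (e * V s x)) \<le> 4" if s: "0 < s" for s
  proof (rule exponential_moment_le_4[OF _ _ e less_imp_le[OF r] er])
    have arctan_less: "arctan (s * w) / s \<le> pi / 2 / s" for w
      using s arctan_ubound[of "s * w"] by (intro divide_right_mono) auto
    show V0: "AE x in \<mu>. 0 \<le> V s x \<and> V s x \<le> pi / 2 / s"
      using W0 by eventually_elim (use s arctan_less in \<open>auto simp: V_def\<close>)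
    \<comment> \<open>Since \<open>V s \<le> W\<close> almost everywhere, the threshold chosen for
      \<open>W\<close> serves every \<open>s\<close>.\<close>
    have "AE x in \<mu>. V s x > r \<longrightarrow> W x > r"
      using W0
    proof eventually_elim
      case (elim x)
      then have "arctan (s * W x) \<le> s * W x" using s by (intro arctan_le_self) auto
      then have "V s x \<le> W x" using s by (simp add: V_def field_simps)
      then show ?case by simp
    qed
    then have "prob {x\<in>space \<mu>. V s x > r} \<le> prob {x\<in>space \<mu>. W x > r}"
      by (intro finite_measure_mono_AE) auto
    with tail show "prob {x\<in>space \<mu>. V s x > r} \<le> exp (- 8 * ln 4) / 2" by simp
    show "V s \<in> borel_measurable \<mu>" by measurable
    fix \<epsilon> assume eps: "0 < \<epsilon>" "\<epsilon> \<le> e" and m4: "expectation (\<lambda>x. exp (\<epsilon> * V s x)) = 4"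
    have bV: "AE x in \<mu>. \<bar>V s x\<bar> \<le> pi / 2 / s \<and> exp (\<epsilon> * V s x) \<le> exp (\<epsilon> * (pi / 2 / s))"
      using V0
    proof eventually_elim
      case (elim x)
      then have "\<epsilon> * V s x \<le> \<epsilon> * (pi / 2 / s)" using eps by (intro mult_left_mono) auto
      then show ?case using elim by simp
    qed
    have i1: "integrable \<mu> (\<lambda>x. exp (\<epsilon> * V s x))"
      by (rule integrable_const_bound[of _ "exp (\<epsilon> * (pi / 2 / s))"]) (use bV in auto)
    have i2: "integrable \<mu> (\<lambda>x. \<epsilon> * V s x * exp (\<epsilon> * V s x))"
    proof (rule integrable_const_bound)
      show "AE x in \<mu>. norm (\<epsilon> * V s x * exp (\<epsilon> * V s x))
          \<le> \<epsilon> * (pi / 2 / s) * exp (\<epsilon> * (pi / 2 / s))"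
        using bV
      proof eventually_elim
        case (elim x)
        then show ?case
          using eps s unfolding real_norm_def abs_mult by (intro mult_mono) auto
      qed
    qed simp
    let ?J = "expectation (\<lambda>x. \<epsilon> * V s x * exp (\<epsilon> * V s x))"
    have J0: "0 \<le> ?J"
      by (rule integral_nonneg_AE) (use V0 eps in \<open>auto elim!: eventually_mono\<close>)
    \<comment> \<open>The division by \<open>q\<close> makes the q-th power of
      \<open>\<psi> (W x)\<close> equal to \<open>exp (\<epsilon> * V s x)\<close>.\<close>
    define \<psi> where "\<psi> u = exp (\<epsilon> / q * (arctan (s * u) / s))" for u
    define \<psi>' where "\<psi>' u = \<psi> u * (\<epsilon> / q) * inverse (1 + (s * u)\<^sup>2)" for u
    have inv: "0 < inverse (1 + (s * u)\<^sup>2)" "inverse (1 + (s * u)\<^sup>2) \<le> 1" for u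
      by (auto intro!: add_pos_nonneg simp: inverse_le_1_iff)
    have "has_subgradient X (\<lambda>x. \<psi> (W x)) (\<lambda>x. \<psi>' (W x) *\<^sub>R DW x)"
    proof (rule has_subgradient_comp[OF W])
      show "(\<psi> has_real_derivative \<psi>' u) (at u)" for u
        unfolding \<psi>_def \<psi>'_def using s q by (auto intro!: derivative_eq_intros)
      show "\<bar>\<psi>' u\<bar> \<le> exp (\<epsilon> / q * (pi / 2 / s)) * (\<epsilon> / q) * 1" for u
      proof -
        have "\<psi> u \<le> exp (\<epsilon> / q * (pi / 2 / s))"
          unfolding \<psi>_def exp_le_cancel_iff
          by (intro mult_left_mono arctan_less) (use eps q in auto)
        moreover have "\<bar>\<psi>' u\<bar> = \<psi> u * (\<epsilon> / q) * inverse (1 + (s * u)\<^sup>2)"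
          using inv[of u] eps q by (simp add: \<psi>'_def \<psi>_def abs_mult)
        moreover have "0 \<le> \<psi> u" by (simp add: \<psi>_def)
        ultimately show ?thesis
          using inv[of u] eps q by (simp only:) (intro mult_mono; simp)
      qed
      show "\<psi>' \<in> borel_measurable borel"
        unfolding \<psi>'_def \<psi>_def by measurable
    qed
    moreover have psi_q: "\<bar>\<psi> (W x)\<bar> powr q = exp (\<epsilon> * V s x)" for x
      using q by (simp add: \<psi>_def V_def powr_def)
    moreover have G: "AE x in \<mu>. norm (\<psi>' (W x) *\<^sub>R DW x) powr q
        \<le> a * \<epsilon> powr (q - 1) * (\<epsilon> * V s x * exp (\<epsilon> * V s x))"
      using bd W0
    proof eventually_elim
      case (elim x)
      \<comment> \<open>\<open>?i\<close> is the derivative of the truncation at \<open>W x\<close>.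
        As \<open>?i \<le> 1\<close> and \<open>q > 1\<close>, its q-th power is at most
        \<open>?i\<close>, and the one remaining factor turns \<open>a * W x\<close> into at most
        \<open>a * V s x\<close>.\<close>
      let ?i = "inverse (1 + (s * W x)\<^sup>2)"
      have iV: "?i * W x \<le> V s x"
        using arctan_ge_self_div_one_plus_square[of "s * W x"] s elim(2)
        by (simp add: V_def field_simps)
      have iq: "?i powr q \<le> ?i"
        using powr_mono'[of 1 q ?i] inv[of "W x"] q by auto
      \<comment> \<open>One factor \<open>\<epsilon>\<close> is split off to rebuild the integrand
        of \<open>?J\<close>; the remaining power is small because \<open>q > 1\<close>.\<close>
      have eq: "(\<epsilon> / q) powr q \<le> \<epsilon> powr (q - 1) * \<epsilon>"
      proof -
        have "(\<epsilon> / q) powr q \<le> \<epsilon> powr q"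
          using eps q by (intro powr_mono2) (auto simp: field_simps)
        also have "\<dots> = \<epsilon> powr (q - 1) * \<epsilon>"
          using eps by (simp add: powr_diff)
        finally show ?thesis .
      qed
      have nrm: "norm (\<psi>' (W x) *\<^sub>R DW x)
          = \<bar>\<psi> (W x)\<bar> * (\<epsilon> / q) * ?i * norm (DW x)"
        using eps q inv[of "W x"] by (simp add: \<psi>'_def \<psi>_def abs_mult)
      have "norm (\<psi>' (W x) *\<^sub>R DW x) powr q
          = exp (\<epsilon> * V s x) * (\<epsilon> / q) powr q * (?i powr q * norm (DW x) powr q)"
      proof -
        have split: "(p * t * i * n) powr q = p powr q * t powr q * (i powr q * n powr q)"
          if "0 \<le> p" "0 \<le> t" "0 \<le> i" "0 \<le> n" for p t i n :: real
          using that by (simp add: powr_mult)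
        show ?thesis
          using eps q inv[of "W x"] unfolding nrm
          by (subst split) (simp_all only: psi_q, simp_all)
      qed
      also have "\<dots> \<le> exp (\<epsilon> * V s x) * (\<epsilon> powr (q - 1) * \<epsilon>) * (?i * (a * W x))"
        using eq iq elim inv[of "W x"] eps by (intro mult_mono) auto
      also have "\<dots> = exp (\<epsilon> * V s x) * (\<epsilon> powr (q - 1) * \<epsilon>) * a * (?i * W x)"
        by simp
      also have "\<dots> \<le> exp (\<epsilon> * V s x) * (\<epsilon> powr (q - 1) * \<epsilon>) * a * V s x"
        using iV eps a by (intro mult_left_mono) auto
      finally show ?case by (simp add: mult_ac)
    qed
    have [measurable]: "\<psi>' \<in> borel_measurable borel"
      unfolding \<psi>'_def \<psi>_def by measurable
    have iG: "integrable \<mu> (\<lambda>x. norm (\<psi>' (W x) *\<^sub>R DW x) powr q)"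
    proof (rule Bochner_Integration.integrable_bound[OF integrable_mult_right[OF i2]])
      show "AE x in \<mu>. norm (norm (\<psi>' (W x) *\<^sub>R DW x) powr q)
          \<le> norm (a * \<epsilon> powr (q - 1) * (\<epsilon> * V s x * exp (\<epsilon> * V s x)))"
        using G by eventually_elim simp
    qed simp
    ultimately have "expectation (\<lambda>x. exp (\<epsilon> * V s x) * ln (exp (\<epsilon> * V s x) / 4))
        \<le> c * expectation (\<lambda>x. norm (\<psi>' (W x) *\<^sub>R DW x) powr q)"
      using LS[of "\<lambda>x. \<psi> (W x)" "\<lambda>x. \<psi>' (W x) *\<^sub>R DW x"] i1 by (simp add: m4)
    also have "expectation (\<lambda>x. norm (\<psi>' (W x) *\<^sub>R DW x) powr q)
        \<le> expectation (\<lambda>x. a * \<epsilon> powr (q - 1) * (\<epsilon> * V s x * exp (\<epsilon> * V s x)))"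
      by (rule integral_mono_AE[OF iG integrable_mult_right[OF i2] G])
    also have "\<dots> = a * \<epsilon> powr (q - 1) * ?J" by simp
    also have "expectation (\<lambda>x. exp (\<epsilon> * V s x) * ln (exp (\<epsilon> * V s x) / 4)) = ?J - 4 * ln 4"
      by (rule entropy_exp) (use i1 i2 m4 in auto)
    also have "c * (a * \<epsilon> powr (q - 1) * ?J) = c * a * \<epsilon> powr (q - 1) * ?J" by simp
    \<comment> \<open>Altogether \<open>?J - 4 * ln 4 \<le> ?J / 2\<close>. Because
      \<open>?J\<close> is finite, half of it can be absorbed, which is the origin of
      \<open>8 * ln 4\<close>.\<close>
    also have "\<dots> \<le> 1 / 2 * ?J" by (intro mult_right_mono small eps J0)
    finally show "?J \<le> 8 * ln 4" using c by simp
  qed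
  define s where "s n = 1 / real (Suc n)" for n
  have s: "0 < s n" for n by (simp add: s_def)
  have lim_s: "filterlim s (at 0) sequentially"
    unfolding filterlim_at s_def using LIMSEQ_inverse_real_of_nat
    by (simp add: inverse_eq_divide)
  have lim: "(\<lambda>n. exp (e * V (s n) x)) \<longlonglongrightarrow> exp (e * W x)" for x
    unfolding V_def
    by (intro tendsto_intros filterlim_compose[OF tendsto_arctan_div lim_s])
  have fin: "(\<integral>\<^sup>+x. ennreal (exp (e * V (s n) x)) \<partial>\<mu>) \<le> 4" for n
  proof -
    have "AE x in \<mu>. norm (exp (e * V (s n) x)) \<le> exp (e * (pi / 2 / s n))"
    proof (rule AE_I2)
      fix x
      have "V (s n) x \<le> pi / 2 / s n"
        unfolding V_def using s[of n] arctan_ubound[of "s n * W x"]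
        by (intro divide_right_mono) auto
      then show "norm (exp (e * V (s n) x)) \<le> exp (e * (pi / 2 / s n))"
        using e by (simp only: real_norm_def abs_exp_cancel exp_le_cancel_iff) (intro mult_left_mono; simp)
    qed
    then have "integrable \<mu> (\<lambda>x. exp (e * V (s n) x))"
      by (rule integrable_const_bound) simp
    then have "(\<integral>\<^sup>+x. ennreal (exp (e * V (s n) x)) \<partial>\<mu>)
        = ennreal (expectation (\<lambda>x. exp (e * V (s n) x)))"
      by (intro nn_integral_eq_integral) auto
    also have "\<dots> \<le> ennreal 4" by (intro ennreal_leI moment s)
    finally show ?thesis by simp
  qed
  \<comment> \<open>Fatou's lemma along \<open>s n\<close>, in nonnegative integrals because the
    limit is not yet known to be integrable.\<close>
  have "(\<integral>\<^sup>+x. ennreal (exp (e * W x)) \<partial>\<mu>)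
      = (\<integral>\<^sup>+x. liminf (\<lambda>n. ennreal (exp (e * V (s n) x))) \<partial>\<mu>)"
    by (intro nn_integral_cong lim_imp_Liminf[symmetric] tendsto_ennrealI lim) simp
  also have "\<dots> \<le> liminf (\<lambda>n. \<integral>\<^sup>+x. ennreal (exp (e * V (s n) x)) \<partial>\<mu>)"
    by (rule nn_integral_liminf) measurable
  also have "\<dots> \<le> limsup (\<lambda>n. \<integral>\<^sup>+x. ennreal (exp (e * V (s n) x)) \<partial>\<mu>)"
    by (rule Liminf_le_Limsup) simp
  also have "\<dots> \<le> 4"
    by (rule Limsup_bounded) (simp add: fin)
  also have "\<dots> < \<infinity>" by simp
  finally have "integrable \<mu> (\<lambda>x. exp (e * W x))"
    by (intro integrableI_nonneg) auto
  with e show ?thesis by blast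
qed

section \<open>Deduction of the U-bound from the entropy inequality\<close>

theorem theorem4p4:
  fixes X :: "'k::finite \<Rightarrow> real ^ 'n \<Rightarrow> real ^ 'n"
    and U :: "real ^ 'n \<Rightarrow> real"
    and DU :: "real ^ 'n \<Rightarrow> real ^ 'k"
    and q a b :: real
  assumes "subgradient_fields X"
    and "1 < q" and "q \<le> 2"
    and "0 < a" and "0 < b"
    and "has_subgradient X U DU"
    and "AE x in lborel. norm (DU x) powr q \<le> a * U x + b"
    and "prob_space (gibbs_measure U)"
    and "LS q X (gibbs_measure U)"
  shows "\<exists>C>0. \<exists>D>0. \<forall>f G. has_subgradient X f G \<longrightarrow>
           integrable (gibbs_measure U) (\<lambda>x. \<bar>f x\<bar> powr q) \<longrightarrow>
           integrable (gibbs_measure U) (\<lambda>x. norm (G x) powr q) \<longrightarrow>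
           integrable (gibbs_measure U) (\<lambda>x. \<bar>f x\<bar> powr q * U x) \<and>
           (LINT x|gibbs_measure U. \<bar>f x\<bar> powr q * U x)
             \<le> C * (LINT x|gibbs_measure U. norm (G x) powr q)
               + D * (LINT x|gibbs_measure U. \<bar>f x\<bar> powr q)"
proof -
  define \<mu> where "\<mu> = gibbs_measure U"
  interpret prob_space \<mu> using assms(8) by (simp add: \<mu>_def)
  have U [measurable]: "U \<in> borel_measurable borel"
    using assms(6) by (simp add: has_subgradient_def)
  have sets [measurable_cong]: "sets \<mu> = sets borel"
    by (simp add: \<mu>_def gibbs_measure_def)
  \<comment> \<open>The shift absorbs \<open>b\<close>, since \<open>a * W x = a * U x + b\<close>,
    and leaves the subgradient unchanged.\<close>
  define W where "W x = U x + b / a" for x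
  have [measurable]: "W \<in> borel_measurable borel" unfolding W_def by measurable
  have DW: "AE x in \<mu>. norm (DU x) powr q \<le> a * W x"
  proof -
    have "AE x in lborel. norm (DU x) powr q \<le> a * W x"
      using assms(4,7) by (simp add: W_def distrib_left)
    then show ?thesis
      unfolding \<mu>_def gibbs_measure_def by (subst AE_density) auto
  qed
  then have W0: "AE x in \<mu>. 0 \<le> W x"
  proof eventually_elim
    case (elim x)
    then have "0 \<le> a * W x" by (rule order_trans[rotated]) simp
    then show ?case using assms(4) by (simp add: zero_le_mult_iff)
  qed
  have "has_subgradient X W DU"
  proof -
    have "((\<lambda>u. u + b / a) has_real_derivative 1) (at u)" for u
      by (auto intro!: derivative_eq_intros)
    from has_subgradient_comp[OF assms(6) this, of 1] show ?thesis
      by (simp add: W_def[abs_def])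
  qed
  from LS_exponential_integrable[OF this DW _ sets _ assms(2,4)] assms(8,9)
  obtain e where e: "e > 0" and iexp: "integrable \<mu> (\<lambda>x. exp (e * W x))"
    by (auto simp: \<mu>_def)
  obtain c where c: "c > 0" and LS: "\<And>f G. has_subgradient X f G \<Longrightarrow>
        integrable \<mu> (\<lambda>x. \<bar>f x\<bar> powr q) \<Longrightarrow> integrable \<mu> (\<lambda>x. norm (G x) powr q) \<Longrightarrow>
        integrable \<mu> (\<lambda>x. \<bar>f x\<bar> powr q * ln (\<bar>f x\<bar> powr q / (LINT y|\<mu>. \<bar>f y\<bar> powr q))) \<and>
        (LINT x|\<mu>. \<bar>f x\<bar> powr q * ln (\<bar>f x\<bar> powr q / (LINT y|\<mu>. \<bar>f y\<bar> powr q)))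
          \<le> c * (LINT x|\<mu>. norm (G x) powr q)"
    using assms(9) unfolding LS_def \<mu>_def by blast
  define m where "m = expectation (\<lambda>x. exp (e * W x))"
  have m0: "0 \<le> m" unfolding m_def by (rule Bochner_Integration.integral_nonneg) simp
  \<comment> \<open>The entropy inequality with \<open>e * W\<close> in the exponent and
    \<open>LS\<close> bound the integral of \<open>\<bar>f\<bar> powr q * (e * W)\<close> by
    \<open>c\<close> times the gradient term plus \<open>m\<close> times the mass; dividing by
    \<open>e\<close> gives the constants. The extra 1 makes \<open>D\<close> positive from
    \<open>0 \<le> m\<close>.\<close>
  have "integrable \<mu> (\<lambda>x. \<bar>f x\<bar> powr q * U x) \<and>
      (LINT x|\<mu>. \<bar>f x\<bar> powr q * U x)
        \<le> c / e * (LINT x|\<mu>. norm (G x) powr q) + (m / e + 1) * (LINT x|\<mu>. \<bar>f x\<bar> powr q)"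
    if f: "has_subgradient X f G" and i: "integrable \<mu> (\<lambda>x. \<bar>f x\<bar> powr q)"
      and iG: "integrable \<mu> (\<lambda>x. norm (G x) powr q)" for f G
  proof -
    let ?g = "\<lambda>x. \<bar>f x\<bar> powr q"
    have [measurable]: "f \<in> borel_measurable borel"
      using f by (simp add: has_subgradient_def)
    have eW: "AE x in \<mu>. 0 \<le> e * W x"
      using W0 e by (auto elim!: eventually_mono)
    \<comment> \<open>The integrability clause of \<open>LS\<close> enters here:
      \<open>entropy_inequality\<close> requires an integrable entropy integrand.\<close>
    note ls = LS[OF f i iG]
    have ieW: "integrable \<mu> (\<lambda>x. ?g x * (e * W x))"
      by (rule entropy_inequality(1)) (use eW ls iexp i in auto)
    have le: "expectation (\<lambda>x. ?g x * (e * W x))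
        \<le> expectation (\<lambda>x. ?g x * ln (?g x / expectation ?g)) + expectation ?g * m"
      unfolding m_def by (rule entropy_inequality(2)) (use eW ls iexp i in auto)
    have gU: "?g x * U x = ?g x * (e * W x) / e - b / a * ?g x" for x
      using e by (simp add: W_def distrib_left add_divide_distrib)
    have iU: "integrable \<mu> (\<lambda>x. ?g x * U x)"
      unfolding gU
      by (intro Bochner_Integration.integrable_diff integrable_divide integrable_mult_right ieW i)
    have "expectation (\<lambda>x. ?g x * U x)
        = expectation (\<lambda>x. ?g x * (e * W x)) / e - b / a * expectation ?g"
      unfolding gU
      by (subst Bochner_Integration.integral_diff)
        (intro integrable_divide integrable_mult_right ieW i
          | simp only: integral_divide_zero integral_mult_right_zero)+
    \<comment> \<open>The term from undoing the shift is nonnegative and is subtracted, so it may be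
      replaced by 0.\<close>
    also have "\<dots> \<le> (c * (LINT x|\<mu>. norm (G x) powr q) + expectation ?g * m) / e - 0"
      using le ls e assms(4,5) by (intro diff_mono divide_right_mono) auto
    also have "\<dots> \<le> c / e * (LINT x|\<mu>. norm (G x) powr q) + (m / e + 1) * expectation ?g"
      by (simp add: add_divide_distrib distrib_right mult.commute)
    finally show ?thesis using iU by blast
  qed
  moreover have "0 < c / e" "0 < m / e + 1"
    using c e m0 by (auto intro: add_nonneg_pos)
  ultimately show ?thesis
    unfolding \<mu>_def by blast
qed

end
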